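(* Assume $\diamondsuit$. Then there is a special $\aleph_1$-tree which is Lindelöf with respect to the fine wedge topology.
   Context: $\diamondsuit$ asserts the existence of a sequence $\langle A_\alpha:\alpha<\omega_1\rangle$ with $A_\alpha\subseteq\alpha$ such that for every $A\subseteq\omega_1$ the set $\{\alpha<\omega_1:A\cap\alpha=A_\alpha\}$ is stationary. A tree is a strict partial order in which the predecessors of each node are well-ordered; an $\aleph_1$-tree is a tree of height $\omega_1$ with all levels countable. An $\aleph_1$-tree is special if it is a countable union of antichains (equivalently, admits an order-preserving map into $\mathbb{Q}$). For $t\in T$ let $\uparrow t=\{y\in T:t\le y\}$; the fine wedge topology on $T$ is generated by the subbase of all sets $\uparrow t$ and their complements. Lindelöf means every open cover has a countable subcover. *)

theory Defs
  imports "HOL-Analysis.Analysis" "HOL-Library.Countable_Set_Type"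
begin

unbundle cardinal_syntax

section \<open>The ordinal \<open>\<omega>\<^sub>1\<close>\<close>

text \<open>
  The elements of this type are the ordinals below \<open>\<omega>\<^sub>1\<close>; an ordinal \<open>\<alpha> < \<omega>\<^sub>1\<close> regarded as a set
  of ordinals is \<open>{..<\<alpha>}\<close>.
\<close>

typedef omega1 = "Field (cardSuc natLeq)"
proof -
  have "Field (cardSuc natLeq) \<noteq> {}"
    using Field_cardSuc_not_empty[OF natLeq_Card_order] .
  then show ?thesis by blast
qed

lemma Well_order_cardSuc_natLeq: "Well_order (cardSuc natLeq)"
  by (rule cardSuc_Well_order[OF natLeq_Card_order])

instantiation omega1 :: wellorder
begin

definition less_eq_omega1 :: "omega1 \<Rightarrow> omega1 \<Rightarrow> bool" where
  "\<alpha> \<le> \<beta> \<longleftrightarrow> (Rep_omega1 \<alpha>, Rep_omega1 \<beta>) \<in> cardSuc natLeq"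

definition less_omega1 :: "omega1 \<Rightarrow> omega1 \<Rightarrow> bool" where
  "\<alpha> < \<beta> \<longleftrightarrow> \<alpha> \<le> \<beta> \<and> \<alpha> \<noteq> (\<beta> :: omega1)"

instance
proof
  let ?r = "cardSuc natLeq"
  have lin: "Linear_order ?r" and wf: "wf (?r - Id)"
    using Well_order_cardSuc_natLeq by (auto simp: well_order_on_def)
  have refl: "refl_on (Field ?r) ?r" and trans: "trans ?r" and anti: "antisym ?r"
    and tot: "total_on (Field ?r) ?r"
    using lin by (auto simp: linear_order_on_def partial_order_on_def preorder_on_def)
  fix x y z :: omega1
  show le_refl: "x \<le> x"
    using refl Rep_omega1 by (auto simp: less_eq_omega1_def refl_on_def)
  show "x \<le> y \<Longrightarrow> y \<le> z \<Longrightarrow> x \<le> z"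
    using trans by (auto simp: less_eq_omega1_def elim: transE)
  show antisym: "x \<le> y \<Longrightarrow> y \<le> x \<Longrightarrow> x = y"
    using anti by (metis less_eq_omega1_def antisymD Rep_omega1_inject)
  show "x < y \<longleftrightarrow> x \<le> y \<and> \<not> y \<le> x"
    using le_refl antisym by (auto simp: less_omega1_def)
  show "x \<le> y \<or> y \<le> x"
    using tot le_refl Rep_omega1[of x] Rep_omega1[of y]
    by (cases "x = y") (auto simp: less_eq_omega1_def total_on_def Rep_omega1_inject)
  fix P :: "omega1 \<Rightarrow> bool" and a
  assume step: "\<And>x. (\<And>y. y < x \<Longrightarrow> P y) \<Longrightarrow> P x"
  have "wf {(x, y). x < (y :: omega1)}"
    by (rule wf_subset[OF wf_inv_image[OF wf, of Rep_omega1]])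
      (auto simp: less_omega1_def less_eq_omega1_def Rep_omega1_inject)
  then show "P a"
    by (induction a rule: wf_induct_rule) (use step in auto)
qed

end

lemma uncountable_omega1: "uncountable (UNIV :: omega1 set)"
proof
  assume "countable (UNIV :: omega1 set)"
  then have "countable (Field (cardSuc natLeq))"
    using type_definition.Rep_range[OF type_definition_omega1] by (metis countable_image)
  then have "|Field (cardSuc natLeq)| \<le>o natLeq"
    by (simp add: countable_card_le_natLeq)
  then have "cardSuc natLeq \<le>o natLeq"
    using card_of_Field_ordIso[OF cardSuc_Card_order[OF natLeq_Card_order]]
    by (meson ordIso_ordLeq_trans ordIso_symmetric)
  then show False
    using cardSuc_greater[OF natLeq_Card_order] not_ordLess_ordLeq by blast
qed

lemma countable_lessThan_omega1: "countable {..<\<alpha> :: omega1}"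
proof -
  have "|underS (cardSuc natLeq) (Rep_omega1 \<alpha>)| <o cardSuc natLeq"
    by (rule card_of_underS[OF cardSuc_Card_order[OF natLeq_Card_order] Rep_omega1])
  then have "countable (underS (cardSuc natLeq) (Rep_omega1 \<alpha>))"
    by (simp add: countable_card_le_natLeq cardSuc_ordLess_ordLeq cardSuc_ordLeq_ordLess
        natLeq_Card_order card_of_Card_order)
  moreover have "Rep_omega1 ` {..<\<alpha>} \<subseteq> underS (cardSuc natLeq) (Rep_omega1 \<alpha>)"
    by (auto simp: underS_def less_omega1_def less_eq_omega1_def Rep_omega1_inject)
  ultimately show ?thesis
    by (metis countable_subset countable_image_inj_on inj_on_subset subset_UNIV
        inj_on_def Rep_omega1_inject)
qed

section \<open>The diamond principle\<close>

text \<open>The premise says that \<open>\<alpha>\<close> is a nonzero ordinal in which \<open>C \<inter> \<alpha>\<close> is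
  unbounded; such an \<open>\<alpha>\<close> is necessarily a limit.\<close>

definition closed_omega1 :: "omega1 set \<Rightarrow> bool" where
  "closed_omega1 C \<longleftrightarrow>
     (\<forall>\<alpha>. {..<\<alpha>} \<noteq> {} \<and> (\<forall>\<beta><\<alpha>. \<exists>\<gamma>\<in>C. \<beta> < \<gamma> \<and> \<gamma> < \<alpha>) \<longrightarrow> \<alpha> \<in> C)"

definition unbounded_omega1 :: "omega1 set \<Rightarrow> bool" where
  "unbounded_omega1 C \<longleftrightarrow> (\<forall>\<beta>. \<exists>\<gamma>\<in>C. \<beta> < \<gamma>)"

definition club :: "omega1 set \<Rightarrow> bool" where
  "club C \<longleftrightarrow> closed_omega1 C \<and> unbounded_omega1 C"

definition stationary :: "omega1 set \<Rightarrow> bool" where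
  "stationary S \<longleftrightarrow> (\<forall>C. club C \<longrightarrow> S \<inter> C \<noteq> {})"

definition diamond :: bool where
  "diamond \<longleftrightarrow>
     (\<exists>A :: omega1 \<Rightarrow> omega1 set.
        (\<forall>\<alpha>. A \<alpha> \<subseteq> {..<\<alpha>}) \<and> (\<forall>X. stationary {\<alpha>. X \<inter> {..<\<alpha>} = A \<alpha>}))"

section \<open>Trees\<close>

text \<open>A tree is given by its set of nodes \<open>T\<close> and its strict order \<open>lt\<close>, of which only the
  restriction to \<open>T\<close> matters.\<close>

definition tree_preds :: "'a set \<Rightarrow> ('a \<Rightarrow> 'a \<Rightarrow> bool) \<Rightarrow> 'a \<Rightarrow> 'a set" where
  "tree_preds T lt t = {s \<in> T. lt s t}"

text \<open>Library well-orders are reflexive, hence the reflexive closure of \<open>lt\<close>.\<close>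

definition tree_pred_order :: "'a set \<Rightarrow> ('a \<Rightarrow> 'a \<Rightarrow> bool) \<Rightarrow> 'a \<Rightarrow> 'a rel" where
  "tree_pred_order T lt t =
     {(x, y). x \<in> tree_preds T lt t \<and> y \<in> tree_preds T lt t \<and> (x = y \<or> lt x y)}"

definition is_tree :: "'a set \<Rightarrow> ('a \<Rightarrow> 'a \<Rightarrow> bool) \<Rightarrow> bool" where
  "is_tree T lt \<longleftrightarrow>
     irreflp_on T lt \<and> transp_on T lt \<and>
     (\<forall>t\<in>T. well_order_on (tree_preds T lt t) (tree_pred_order T lt t))"

definition tree_level :: "'a set \<Rightarrow> ('a \<Rightarrow> 'a \<Rightarrow> bool) \<Rightarrow> omega1 \<Rightarrow> 'a set" where
  "tree_level T lt \<alpha> = {t \<in> T. tree_pred_order T lt t =o {(\<beta>, \<gamma>). \<beta> \<le> \<gamma> \<and> \<gamma> < \<alpha>}}"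

text \<open>The height of a tree is the least ordinal whose level is empty. It is \<open>\<omega>\<^sub>1\<close> iff all
  levels below \<open>\<omega>\<^sub>1\<close> are nonempty and every node lies on one of them.\<close>

definition height_omega1 :: "'a set \<Rightarrow> ('a \<Rightarrow> 'a \<Rightarrow> bool) \<Rightarrow> bool" where
  "height_omega1 T lt \<longleftrightarrow>
     (\<forall>\<alpha>. tree_level T lt \<alpha> \<noteq> {}) \<and> (\<forall>t\<in>T. \<exists>\<alpha>. t \<in> tree_level T lt \<alpha>)"

definition aleph1_tree :: "'a set \<Rightarrow> ('a \<Rightarrow> 'a \<Rightarrow> bool) \<Rightarrow> bool" where
  "aleph1_tree T lt \<longleftrightarrow>
     is_tree T lt \<and> height_omega1 T lt \<and> (\<forall>\<alpha>. countable (tree_level T lt \<alpha>))"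

definition tree_antichain :: "'a set \<Rightarrow> ('a \<Rightarrow> 'a \<Rightarrow> bool) \<Rightarrow> 'a set \<Rightarrow> bool" where
  "tree_antichain T lt A \<longleftrightarrow> A \<subseteq> T \<and> (\<forall>x\<in>A. \<forall>y\<in>A. \<not> lt x y)"

definition special_tree :: "'a set \<Rightarrow> ('a \<Rightarrow> 'a \<Rightarrow> bool) \<Rightarrow> bool" where
  "special_tree T lt \<longleftrightarrow>
     (\<exists>A :: nat \<Rightarrow> 'a set. (\<forall>n. tree_antichain T lt (A n)) \<and> T = (\<Union>n. A n))"

definition up_set :: "'a set \<Rightarrow> ('a \<Rightarrow> 'a \<Rightarrow> bool) \<Rightarrow> 'a \<Rightarrow> 'a set" where
  "up_set T lt t = {y \<in> T. t = y \<or> lt t y}"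

definition fine_wedge_topology :: "'a set \<Rightarrow> ('a \<Rightarrow> 'a \<Rightarrow> bool) \<Rightarrow> 'a topology" where
  "fine_wedge_topology T lt =
     topology_generated_by (up_set T lt ` T \<union> (\<lambda>t. T - up_set T lt t) ` T)"

lemma topspace_fine_wedge_topology: "topspace (fine_wedge_topology T lt) = T"
  unfolding fine_wedge_topology_def topology_generated_by_topspace by (auto simp: up_set_def)

end

theory Submission
  imports Defs
begin

text \<open>
  In the fine wedge topology, \<open>x\<close> has a neighbourhood base consisting of the sets \<open>\<up>x\<close> minus
  finitely many \<open>\<up>s\<close> with \<open>s > x\<close>, and each of these contains all of \<open>\<up>x\<close> except what lies above
  finitely many immediate successors of \<open>x\<close>. Hence a tree with countable levels is Lindelof as
  soon as for every set \<open>A\<close> of nodes containing only finitely many immediate successors of each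
  node there is a level \<open>\<alpha>\<close> such that the branch to any node of level \<open>\<alpha>\<close> leaves \<open>A\<close>, that is,
  passes through a node of successor level outside \<open>A\<close>. The usual recursive construction of a
  special Aronszajn tree, with rational labels and infinitely many immediate successors of
  arbitrarily close label above each node, leaves enough room to let every branch extended at a
  limit level \<open>\<alpha>\<close> leave the set \<open>A\<^sub>\<alpha>\<close> guessed by diamond: its first step above the given node
  avoids the finitely many immediate successors in \<open>A\<^sub>\<alpha>\<close>.
\<close>

section \<open>Choice principles\<close>

lemma ex_map_infinite_fibres:
  assumes "infinite L" "countable D" "D \<noteq> {}"
  shows "\<exists>d. d ` L \<subseteq> D \<and> (\<forall>z\<in>D. infinite {x \<in> L. d x = z})"
proof -
  have "|D \<times> (UNIV :: nat set)| \<le>o |UNIV :: nat set|"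
    using assms(2) by (simp flip: countable_card_of_nat)
  also have "|UNIV :: nat set| \<le>o |L|"
    using assms(1) by (simp add: infinite_iff_card_of_nat)
  finally have "|D \<times> (UNIV :: nat set)| \<le>o |L|" .
  moreover have "D \<times> (UNIV :: nat set) \<noteq> {}"
    using assms(3) by simp
  ultimately obtain e :: "'a \<Rightarrow> 'b \<times> nat" where e: "e ` L = D \<times> UNIV"
    using card_of_ordLeq2[of "D \<times> UNIV" L] by blast
  have "infinite {x \<in> L. fst (e x) = z}" if "z \<in> D" for z
  proof -
    have "e ` {x \<in> L. fst (e x) = z} = {w \<in> D \<times> UNIV. fst w = z}"
      unfolding e[symmetric] by auto
    also have "\<dots> = {z} \<times> UNIV"
      using that by auto
    finally have "infinite (e ` {x \<in> L. fst (e x) = z})"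
      by (simp add: finite_cartesian_product_iff)
    then show ?thesis
      using finite_imageI by blast
  qed
  moreover have "(fst \<circ> e) ` L \<subseteq> D"
    unfolding image_comp[symmetric] e by auto
  ultimately show ?thesis
    by (intro exI[of _ "fst \<circ> e"]) simp
qed

lemma ex_levelwise_choice:
  fixes lev :: "'a \<Rightarrow> 'i::wellorder" and Q :: "('a \<Rightarrow> 'b) \<Rightarrow> 'i \<Rightarrow> bool"
  assumes cong: "\<And>F F' \<alpha>. (\<And>x. lev x \<le> \<alpha> \<Longrightarrow> F x = F' x) \<Longrightarrow> Q F \<alpha> = Q F' \<alpha>"
    and extension: "\<And>F \<alpha>. (\<And>\<beta>. \<beta> < \<alpha> \<Longrightarrow> Q F \<beta>) \<Longrightarrow>
      \<exists>F'. (\<forall>x. lev x < \<alpha> \<longrightarrow> F' x = F x) \<and> Q F' \<alpha>"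
  shows "\<exists>F. \<forall>\<alpha>. Q F \<alpha>"
proof -
  define glue where "glue g x = g (lev x) x" for g :: "'i \<Rightarrow> 'a \<Rightarrow> 'b" and x
  have glue_upd: "Q (glue (g(\<alpha> := r))) \<alpha> = Q F \<alpha>"
    if "\<And>x. lev x < \<alpha> \<Longrightarrow> F x = glue g x" "\<And>x. lev x = \<alpha> \<Longrightarrow> F x = r x" for g F \<alpha> r
    by (rule cong) (use that in \<open>auto simp: glue_def order_le_less\<close>)
  have "\<exists>g. \<forall>\<alpha>. Q (glue (g(\<alpha> := g \<alpha>))) \<alpha>"
  proof (rule dependent_wf_choice[OF wf])
    fix g g' :: "'i \<Rightarrow> 'a \<Rightarrow> 'b" and \<alpha> r
    assume "\<And>\<beta>. (\<beta>, \<alpha>) \<in> {(x, y). x < y} \<Longrightarrow> g \<beta> = g' \<beta>"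
    then show "Q (glue (g(\<alpha> := r))) \<alpha> = Q (glue (g'(\<alpha> := r))) \<alpha>"
      by (intro glue_upd) (auto simp: glue_def)
  next
    fix \<alpha> and g :: "'i \<Rightarrow> 'a \<Rightarrow> 'b"
    assume "\<And>\<beta>. (\<beta>, \<alpha>) \<in> {(x, y). x < y} \<Longrightarrow> Q (glue (g(\<beta> := g \<beta>))) \<beta>"
    then obtain F where "\<forall>x. lev x < \<alpha> \<longrightarrow> F x = glue g x" "Q F \<alpha>"
      using extension[of \<alpha> "glue g"] by auto
    then show "\<exists>r. Q (glue (g(\<alpha> := r))) \<alpha>"
      using glue_upd[of \<alpha> F g F] by auto
  qed
  then show ?thesis
    by auto
qed

lemma ex_mono_cofinal_sequence:
  fixes I :: "'i::linorder set"
  assumes "countable I" "i \<in> I"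
  shows "\<exists>s :: nat \<Rightarrow> 'i. s 0 = i \<and> mono s \<and> range s \<subseteq> I \<and> (\<forall>j\<in>I. \<exists>n. j \<le> s n)"
proof -
  define e where "e = from_nat_into I"
  define s where "s n = Max (insert i (e ` {..<n}))" for n
  have "e n \<in> I" for n
    using from_nat_into[of I n] assms(2) by (auto simp: e_def)
  then have "insert i (e ` {..<n}) \<subseteq> I" for n
    using assms(2) by auto
  moreover have "s n \<in> insert i (e ` {..<n})" for n
    unfolding s_def by (rule Max_in) auto
  ultimately have "range s \<subseteq> I"
    by blast
  moreover have "mono s"
    unfolding s_def by (intro monoI Max_mono) auto
  moreover have "\<exists>n. j \<le> s n" if j: "j \<in> I" for j
  proof -
    obtain n where "e n = j"
      using from_nat_into_surj[OF assms(1) j] by (auto simp: e_def)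
    then have "j \<le> s (Suc n)"
      unfolding s_def by (intro Max_ge) auto
    then show ?thesis ..
  qed
  moreover have "s 0 = i"
    by (simp add: s_def)
  ultimately show ?thesis
    by blast
qed

lemma ex_thread_inverse_sequence:
  fixes X :: "nat \<Rightarrow> 'a set"
  assumes surj: "\<And>n. \<pi> n ` X (Suc n) = X n" and x: "x \<in> X 0"
  shows "\<exists>y. y 0 = x \<and> (\<forall>n. y n \<in> X n \<and> \<pi> n (y (Suc n)) = y n)"
proof -
  have "\<exists>y. \<forall>n. (y n \<in> X n \<and> (n = 0 \<longrightarrow> y n = x)) \<and> \<pi> n (y (Suc n)) = y n"
  proof (rule dependent_nat_choice)
    fix y n
    assume "y \<in> X n \<and> (n = 0 \<longrightarrow> y = x)"
    then have "y \<in> \<pi> n ` X (Suc n)"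
      by (simp add: surj)
    then show "\<exists>z. (z \<in> X (Suc n) \<and> (Suc n = 0 \<longrightarrow> z = x)) \<and> \<pi> n z = y"
      by auto
  qed (use x in blast)
  then show ?thesis
    by blast
qed

locale inverse_system =
  fixes I :: "'i::linorder set" and X :: "'i \<Rightarrow> 'a set" and \<pi> :: "'i \<Rightarrow> 'i \<Rightarrow> 'a \<Rightarrow> 'a"
  assumes image_proj: "i \<in> I \<Longrightarrow> j \<in> I \<Longrightarrow> i \<le> j \<Longrightarrow> \<pi> i j ` X j = X i"
    and proj_id: "i \<in> I \<Longrightarrow> x \<in> X i \<Longrightarrow> \<pi> i i x = x"
    and proj_comp: "i \<in> I \<Longrightarrow> j \<in> I \<Longrightarrow> k \<in> I \<Longrightarrow> i \<le> j \<Longrightarrow> j \<le> k \<Longrightarrow> x \<in> X k \<Longrightarrow>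
      \<pi> i j (\<pi> j k x) = \<pi> i k x"
begin

definition thread :: "('i \<Rightarrow> 'a) \<Rightarrow> bool" where
  "thread b \<longleftrightarrow> (\<forall>i\<in>I. b i \<in> X i) \<and> (\<forall>i\<in>I. \<forall>j\<in>I. i \<le> j \<longrightarrow> \<pi> i j (b j) = b i)"

lemma proj_mono_sequence:
  fixes s :: "nat \<Rightarrow> 'i"
  assumes s_I: "\<And>n. s n \<in> I" and "mono s" and y: "\<And>n. y n \<in> X (s n)"
    and y_Suc: "\<And>n. \<pi> (s n) (s (Suc n)) (y (Suc n)) = y n"
    and "m \<le> n" and i: "i \<in> I" "i \<le> s m"
  shows "\<pi> i (s n) (y n) = \<pi> i (s m) (y m)"
  using \<open>m \<le> n\<close>
proof (induction rule: dec_induct)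
  case (step n)
  have "i \<le> s n" "s n \<le> s (Suc n)"
    using i(2) step.hyps monoD[OF \<open>mono s\<close>, of m n] monoD[OF \<open>mono s\<close>, of n "Suc n"] by auto
  then have "\<pi> i (s (Suc n)) (y (Suc n)) = \<pi> i (s n) (\<pi> (s n) (s (Suc n)) (y (Suc n)))"
    using proj_comp i(1) s_I y by simp
  then show ?case
    using y_Suc step.IH by simp
qed simp

lemma ex_thread_extending_sequence:
  fixes s :: "nat \<Rightarrow> 'i"
  assumes s_I: "\<And>n. s n \<in> I" and "mono s" and cofinal: "\<And>i. i \<in> I \<Longrightarrow> \<exists>n. i \<le> s n"
    and y: "\<And>n. y n \<in> X (s n)" and y_Suc: "\<And>n. \<pi> (s n) (s (Suc n)) (y (Suc n)) = y n"
  shows "\<exists>b. thread b \<and> (\<forall>n. b (s n) = y n)"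
proof -
  define b where "b i = \<pi> i (s (LEAST n. i \<le> s n)) (y (LEAST n. i \<le> s n))" for i
  have b: "b i = \<pi> i (s n) (y n)" if "i \<in> I" "i \<le> s n" for i n
  proof -
    have "i \<le> s (LEAST n. i \<le> s n)" "(LEAST n. i \<le> s n) \<le> n"
      using that(2) by (auto intro: LeastI Least_le)
    then show ?thesis
      unfolding b_def using proj_mono_sequence[OF s_I \<open>mono s\<close> y y_Suc] that(1) by metis
  qed
  have "b i \<in> X i" if "i \<in> I" for i
    using cofinal[OF that] b[OF that] image_proj[OF that s_I] y by blast
  moreover have "\<pi> i j (b j) = b i" if "i \<in> I" "j \<in> I" "i \<le> j" for i j
  proof -
    obtain n where "j \<le> s n"
      using cofinal \<open>j \<in> I\<close> by blast
    then show ?thesis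
      using b[of i n] b[of j n] proj_comp[of i j "s n" "y n"] that s_I y by simp
  qed
  ultimately have "thread b"
    by (simp add: thread_def)
  moreover have "b (s n) = y n" for n
    using b[of "s n" n] proj_id s_I y by simp
  ultimately show ?thesis
    by blast
qed

lemma ex_thread_through:
  assumes "countable I" and i: "i \<in> I" and x: "x \<in> X i"
  shows "\<exists>b. thread b \<and> b i = x"
proof -
  obtain s :: "nat \<Rightarrow> 'i" where s_0: "s 0 = i" and "mono s" and s_I: "\<And>n. s n \<in> I"
    and cofinal: "\<And>j. j \<in> I \<Longrightarrow> \<exists>n. j \<le> s n"
    using ex_mono_cofinal_sequence[OF \<open>countable I\<close> i] by (auto simp: image_subset_iff)
  have "\<pi> (s n) (s (Suc n)) ` X (s (Suc n)) = X (s n)" for n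
    using image_proj[OF s_I s_I] monoD[OF \<open>mono s\<close>, of n "Suc n"] by simp
  then obtain y where y_0: "y 0 = x" and y: "\<And>n. y n \<in> X (s n)"
    and y_Suc: "\<And>n. \<pi> (s n) (s (Suc n)) (y (Suc n)) = y n"
    using ex_thread_inverse_sequence[of "\<lambda>n. \<pi> (s n) (s (Suc n))" "\<lambda>n. X (s n)" x] x s_0 by auto
  obtain b where "thread b" "\<forall>n. b (s n) = y n"
    using ex_thread_extending_sequence[OF s_I \<open>mono s\<close> cofinal y y_Suc] by blast
  then show ?thesis
    using s_0 y_0 by metis
qed

end

section \<open>Countable ordinals\<close>

lemma ex_strict_supremum_omega1:
  fixes S :: "omega1 set"
  assumes "countable S"
  shows "\<exists>\<alpha>. (\<forall>\<beta>\<in>S. \<beta> < \<alpha>) \<and> (\<forall>\<gamma><\<alpha>. \<exists>\<beta>\<in>S. \<gamma> \<le> \<beta>)"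
proof -
  have "countable (\<Union>\<beta>\<in>S. {..\<beta>})"
    using assms countable_lessThan_omega1 by (auto simp: ivl_disj_un_singleton(2)[symmetric])
  then obtain \<alpha> where "\<alpha> \<notin> (\<Union>\<beta>\<in>S. {..\<beta>})"
    using uncountable_omega1 by (metis UNIV_I subsetI countable_subset)
  then have "\<forall>\<beta>\<in>S. \<beta> < \<alpha>"
    by (auto simp: not_le)
  then have "\<forall>\<beta>\<in>S. \<beta> < (LEAST \<alpha>. \<forall>\<beta>\<in>S. \<beta> < \<alpha>)"
    by (rule LeastI)
  moreover have "\<exists>\<beta>\<in>S. \<gamma> \<le> \<beta>" if "\<gamma> < (LEAST \<alpha>. \<forall>\<beta>\<in>S. \<beta> < \<alpha>)" for \<gamma>
    using not_less_Least[OF that] by (auto simp: not_less)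
  ultimately show ?thesis
    by blast
qed

definition suc_omega1 :: "omega1 \<Rightarrow> omega1" where
  "suc_omega1 \<alpha> = (LEAST \<beta>. \<alpha> < \<beta>)"

lemma less_suc_omega1: "\<alpha> < suc_omega1 \<alpha>"
  unfolding suc_omega1_def using ex_strict_supremum_omega1[of "{\<alpha>}"] by (auto intro: LeastI_ex)

lemma suc_omega1_le: "\<alpha> < \<beta> \<Longrightarrow> suc_omega1 \<alpha> \<le> \<beta>"
  unfolding suc_omega1_def by (rule Least_le)

lemma suc_omega1_inject: "suc_omega1 \<alpha> = suc_omega1 \<beta> \<Longrightarrow> \<alpha> = \<beta>"
  by (metis less_suc_omega1 suc_omega1_le linorder_neq_iff not_less)

definition limit_omega1 :: "omega1 \<Rightarrow> bool" where
  "limit_omega1 \<alpha> \<longleftrightarrow> {..<\<alpha>} \<noteq> {} \<and> (\<forall>\<beta><\<alpha>. suc_omega1 \<beta> < \<alpha>)"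

lemma ex_closure_point_greater:
  fixes h :: "omega1 \<Rightarrow> omega1"
  shows "\<exists>\<alpha>>\<beta>. \<forall>\<gamma><\<alpha>. h \<gamma> < \<alpha>"
proof -
  have "\<exists>\<delta>. \<forall>\<gamma>\<in>insert \<alpha> (h ` insert \<alpha> {..<\<alpha>}). \<gamma> < \<delta>" for \<alpha>
    using ex_strict_supremum_omega1[of "insert \<alpha> (h ` insert \<alpha> {..<\<alpha>})"]
      countable_lessThan_omega1 by auto
  then obtain k where k: "\<And>\<alpha> \<gamma>. \<gamma> \<le> \<alpha> \<Longrightarrow> h \<gamma> < k \<alpha>"
    by (metis image_eqI insert_iff lessThan_iff order_le_less)
  define s where "s n = (k ^^ n) \<beta>" for n
  obtain \<alpha> where s_less: "\<And>n. s n < \<alpha>" and cofinal: "\<And>\<gamma>. \<gamma> < \<alpha> \<Longrightarrow> \<exists>n. \<gamma> \<le> s n"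
    using ex_strict_supremum_omega1[of "range s"] by auto
  have "h \<gamma> < \<alpha>" if "\<gamma> < \<alpha>" for \<gamma>
  proof -
    obtain n where "\<gamma> \<le> s n"
      using cofinal[OF \<open>\<gamma> < \<alpha>\<close>] by blast
    then have "h \<gamma> < s (Suc n)"
      using k by (simp add: s_def)
    then show ?thesis
      using s_less order.strict_trans by blast
  qed
  moreover have "\<beta> < \<alpha>"
    using s_less[of 0] by (simp add: s_def)
  ultimately show ?thesis
    by blast
qed

lemma club_closure_points: "club {\<alpha>. {..<\<alpha>} \<noteq> {} \<and> (\<forall>\<beta><\<alpha>. h \<beta> < \<alpha>)}"
  unfolding club_def
proof
  show "closed_omega1 {\<alpha>. {..<\<alpha>} \<noteq> {} \<and> (\<forall>\<beta><\<alpha>. h \<beta> < \<alpha>)}"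
    unfolding closed_omega1_def using order.strict_trans by blast
  show "unbounded_omega1 {\<alpha>. {..<\<alpha>} \<noteq> {} \<and> (\<forall>\<beta><\<alpha>. h \<beta> < \<alpha>)}"
    unfolding unbounded_omega1_def using ex_closure_point_greater[of _ h] by fastforce
qed

lemma ex_countably_infinite_fibres_omega1:
  "\<exists>f :: omega1 \<Rightarrow> omega1. \<forall>\<alpha>. countable {x. f x = \<alpha>} \<and> infinite {x. f x = \<alpha>}"
proof -
  have inf: "infinite (UNIV :: omega1 set)"
    using uncountable_omega1 countable_finite by blast
  then have "|UNIV :: nat set| \<le>o |UNIV :: omega1 set|"
    by (simp add: infinite_iff_card_of_nat)
  then have "|UNIV :: omega1 set| =o |(UNIV :: omega1 set) \<times> (UNIV :: nat set)|"
    using inf card_of_Times_infinite_simps(1) ordIso_symmetric by blast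
  then obtain M :: "omega1 \<Rightarrow> omega1 \<times> nat" where M: "bij M"
    by (auto simp: card_of_ordIso[symmetric])
  have image: "M ` {x. fst (M x) = \<alpha>} = {\<alpha>} \<times> UNIV" for \<alpha>
  proof -
    have "M ` {x. fst (M x) = \<alpha>} = {w \<in> range M. fst w = \<alpha>}"
      by auto
    then show ?thesis
      using bij_is_surj[OF M] by auto
  qed
  have "countable {x. fst (M x) = \<alpha>}" for \<alpha>
    by (rule countable_image_inj_on[of M])
      (simp_all add: image inj_on_subset[OF bij_is_inj[OF M]])
  moreover have "infinite {x. fst (M x) = \<alpha>}" for \<alpha>
  proof
    assume "finite {x. fst (M x) = \<alpha>}"
    then have "finite ({\<alpha>} \<times> (UNIV :: nat set))"
      unfolding image[symmetric] by (rule finite_imageI)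
    then show False
      by (simp add: finite_cartesian_product_iff)
  qed
  ultimately show ?thesis
    by (intro exI[of _ "fst \<circ> M"]) simp
qed

definition segment_omega1 :: "omega1 \<Rightarrow> omega1 rel" where
  "segment_omega1 \<alpha> = {(\<beta>, \<gamma>). \<beta> \<le> \<gamma> \<and> \<gamma> < \<alpha>}"

lemma Field_segment_omega1: "Field (segment_omega1 \<alpha>) = {..<\<alpha>}"
  by (auto simp: Field_def segment_omega1_def)

lemma Well_order_segment_omega1: "Well_order (segment_omega1 \<alpha>)"
proof -
  have "wf (segment_omega1 \<alpha> - Id)"
    by (rule wf_subset[OF wf]) (auto simp: segment_omega1_def)
  then show ?thesis
    unfolding well_order_on_def linear_order_on_def partial_order_on_def preorder_on_def
      Field_segment_omega1
    by (auto simp: refl_on_def trans_def antisym_def total_on_def segment_omega1_def)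
qed

lemma segment_omega1_ordLess:
  assumes "\<alpha> < \<beta>"
  shows "segment_omega1 \<alpha> <o segment_omega1 \<beta>"
proof -
  have "Restr (segment_omega1 \<beta>) (underS (segment_omega1 \<beta>) \<alpha>) = segment_omega1 \<alpha>"
    using assms by (auto simp: underS_def segment_omega1_def)
  moreover have "Field (segment_omega1 \<beta>) \<noteq> {}"
    using assms by (auto simp: Field_segment_omega1)
  ultimately show ?thesis
    using underS_Restr_ordLess[OF Well_order_segment_omega1] by metis
qed

lemma segment_omega1_ordIso_iff: "segment_omega1 \<alpha> =o segment_omega1 \<beta> \<longleftrightarrow> \<alpha> = \<beta>"
  by (metis Well_order_segment_omega1 linorder_less_linear not_ordLess_ordIso ordIso_reflexive
      ordIso_symmetric segment_omega1_ordLess)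

section \<open>Special trees and the fine wedge topology\<close>

lemma special_treeI:
  fixes f :: "'a \<Rightarrow> 'b::countable"
  assumes "\<And>x y. x \<in> T \<Longrightarrow> y \<in> T \<Longrightarrow> lt x y \<Longrightarrow> f x \<noteq> f y"
  shows "special_tree T lt"
  unfolding special_tree_def
proof (intro exI conjI allI)
  show "tree_antichain T lt {x \<in> T. to_nat (f x) = n}" for n
    using assms by (fastforce simp: tree_antichain_def)
  show "T = (\<Union>n. {x \<in> T. to_nat (f x) = n})"
    by auto
qed

lemma tree_less_trans:
  assumes "is_tree T lt" "x \<in> T" "y \<in> T" "z \<in> T" "lt x y" "lt y z"
  shows "lt x z"
  using assms unfolding is_tree_def by (meson transp_onD)

lemma tree_less_irrefl: "is_tree T lt \<Longrightarrow> x \<in> T \<Longrightarrow> \<not> lt x x"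
  by (auto simp: is_tree_def irreflp_on_def)

lemma tree_preds_comparable:
  assumes "is_tree T lt" "x \<in> T" "y \<in> T" "z \<in> T" "lt x z" "lt y z"
  shows "x = y \<or> lt x y \<or> lt y x"
proof -
  have "total_on (tree_preds T lt z) (tree_pred_order T lt z)"
    using assms by (simp add: is_tree_def well_order_on_def linear_order_on_def)
  moreover have "x \<in> tree_preds T lt z" "y \<in> tree_preds T lt z"
    using assms by (auto simp: tree_preds_def)
  ultimately show ?thesis
    by (auto simp: total_on_def tree_pred_order_def)
qed

lemma up_set_mono:
  assumes "is_tree T lt" "t \<in> T" "x \<in> up_set T lt t"
  shows "up_set T lt x \<subseteq> up_set T lt t"
  using assms tree_less_trans unfolding up_set_def by fast

lemma up_set_disjoint:
  assumes T: "is_tree T lt" and "x \<in> T" "t \<in> T" and "x \<notin> up_set T lt t" "\<not> lt x t"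
  shows "up_set T lt x \<inter> up_set T lt t = {}"
proof -
  have False if y: "y \<in> T" "x = y \<or> lt x y" "t = y \<or> lt t y" for y
    using assms y tree_preds_comparable[OF T, of x t y] by (auto simp: up_set_def)
  then show ?thesis
    by (auto simp: up_set_def)
qed

definition wedge :: "'a set \<Rightarrow> ('a \<Rightarrow> 'a \<Rightarrow> bool) \<Rightarrow> 'a \<Rightarrow> 'a set \<Rightarrow> 'a set" where
  "wedge T lt x F = up_set T lt x - (\<Union>s\<in>F. up_set T lt s)"

definition contains_wedge :: "'a set \<Rightarrow> ('a \<Rightarrow> 'a \<Rightarrow> bool) \<Rightarrow> 'a \<Rightarrow> 'a set \<Rightarrow> bool" where
  "contains_wedge T lt x U \<longleftrightarrow>
     (\<exists>F. finite F \<and> F \<subseteq> up_set T lt x - {x} \<and> wedge T lt x F \<subseteq> U)"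

lemma contains_wedge_mono: "contains_wedge T lt x U \<Longrightarrow> U \<subseteq> V \<Longrightarrow> contains_wedge T lt x V"
  unfolding contains_wedge_def by (meson subset_trans)

lemma contains_wedge_Int:
  assumes "contains_wedge T lt x U" "contains_wedge T lt x V"
  shows "contains_wedge T lt x (U \<inter> V)"
proof -
  obtain F G where
    "finite F \<and> F \<subseteq> up_set T lt x - {x} \<and> wedge T lt x F \<subseteq> U"
    "finite G \<and> G \<subseteq> up_set T lt x - {x} \<and> wedge T lt x G \<subseteq> V"
    using assms by (auto simp: contains_wedge_def)
  moreover have "wedge T lt x (F \<union> G) = wedge T lt x F \<inter> wedge T lt x G"
    by (auto simp: wedge_def)
  ultimately show ?thesis
    unfolding contains_wedge_def by (intro exI[of _ "F \<union> G"]) blast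
qed

lemma contains_wedge_if_up_set_subset: "up_set T lt x \<subseteq> U \<Longrightarrow> contains_wedge T lt x U"
  unfolding contains_wedge_def by (intro exI[of _ "{}"]) (simp add: wedge_def)

lemma contains_wedge_Diff_up_set:
  assumes T: "is_tree T lt" and "t \<in> T" "x \<in> T" "x \<notin> up_set T lt t"
  shows "contains_wedge T lt x (T - up_set T lt t)"
proof (cases "lt x t")
  case True
  then have "{t} \<subseteq> up_set T lt x - {x}"
    using tree_less_irrefl[OF T \<open>t \<in> T\<close>] \<open>t \<in> T\<close> by (auto simp: up_set_def)
  moreover have "wedge T lt x {t} \<subseteq> T - up_set T lt t"
    by (auto simp: wedge_def up_set_def)
  ultimately show ?thesis
    unfolding contains_wedge_def by (intro exI[of _ "{t}"]) simp
next
  case False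
  then have "up_set T lt x \<inter> up_set T lt t = {}"
    using up_set_disjoint[OF T] assms by blast
  then show ?thesis
    by (intro contains_wedge_if_up_set_subset) (auto simp: up_set_def)
qed

lemma contains_wedge_if_openin:
  assumes T: "is_tree T lt" and "openin (fine_wedge_topology T lt) U" "x \<in> U"
  shows "contains_wedge T lt x U"
proof -
  have "x \<in> T"
    using openin_subset[OF assms(2)] assms(3) by (auto simp: topspace_fine_wedge_topology)
  with assms(2,3) show ?thesis
    unfolding fine_wedge_topology_def openin_topology_generated_by_iff
  proof (induction arbitrary: x)
    case Empty
    then show ?case by simp
  next
    case (Int U V)
    then show ?case
      by (simp add: contains_wedge_Int)
  next
    case (UN \<U>)
    then obtain U where U: "U \<in> \<U>" "x \<in> U"
      by blast
    show ?case
      using UN.IH[OF U \<open>x \<in> T\<close>] U(1) by (blast intro: contains_wedge_mono)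
  next
    case (Basis U)
    then consider t where "t \<in> T" "U = up_set T lt t" | t where "t \<in> T" "U = T - up_set T lt t"
      by blast
    then show ?case
    proof cases
      case 1
      then show ?thesis
        using up_set_mono[OF T] Basis.prems by (simp add: contains_wedge_if_up_set_subset)
    next
      case 2
      then show ?thesis
        using contains_wedge_Diff_up_set[OF T] Basis.prems by simp
    qed
  qed
qed

lemma Lindelof_space_fine_wedgeI:
  assumes T: "is_tree T lt"
    and cover: "\<And>F. (\<And>x. x \<in> T \<Longrightarrow> finite (F x) \<and> F x \<subseteq> up_set T lt x - {x}) \<Longrightarrow>
      \<exists>C. countable C \<and> C \<subseteq> T \<and> T \<subseteq> (\<Union>x\<in>C. wedge T lt x (F x))"
  shows "Lindelof_space (fine_wedge_topology T lt)"
  unfolding Lindelof_space_def topspace_fine_wedge_topology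
proof (intro allI impI, elim conjE)
  fix \<U>
  assume "\<forall>U\<in>\<U>. openin (fine_wedge_topology T lt) U" and \<U>: "\<Union>\<U> = T"
  then have "\<exists>U\<in>\<U>. contains_wedge T lt x U" if "x \<in> T" for x
    using that contains_wedge_if_openin[OF T] by blast
  then obtain U where U: "\<And>x. x \<in> T \<Longrightarrow> U x \<in> \<U>"
    and "\<And>x. x \<in> T \<Longrightarrow> contains_wedge T lt x (U x)"
    by metis
  then obtain F where F: "\<And>x. x \<in> T \<Longrightarrow> finite (F x) \<and> F x \<subseteq> up_set T lt x - {x}"
    and wedge_U: "\<And>x. x \<in> T \<Longrightarrow> wedge T lt x (F x) \<subseteq> U x"
    unfolding contains_wedge_def by metis
  obtain C where "countable C" and C: "C \<subseteq> T" and T_C: "T \<subseteq> (\<Union>x\<in>C. wedge T lt x (F x))"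
    using cover[OF F] by auto
  have "U ` C \<subseteq> \<U>"
    using U C by auto
  moreover have "(\<Union>x\<in>C. wedge T lt x (F x)) \<subseteq> \<Union>(U ` C)"
    using C wedge_U by (intro UN_mono) auto
  then have "T \<subseteq> \<Union>(U ` C)"
    using T_C by (rule subset_trans[rotated])
  ultimately show "\<exists>\<V>. countable \<V> \<and> \<V> \<subseteq> \<U> \<and> \<Union>\<V> = T"
    using \<open>countable C\<close> \<U> by (intro exI[of _ "U ` C"]) auto
qed

section \<open>Trees given by levels and projections\<close>

locale leveling =
  fixes lev :: "'a \<Rightarrow> omega1"
  assumes countable_level: "countable {x. lev x = \<alpha>}"
begin

definition below :: "omega1 \<Rightarrow> 'a set" where
  "below \<alpha> = {x. lev x < \<alpha>}"

lemma countable_below: "countable (below \<alpha>)"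
proof -
  have "below \<alpha> = (\<Union>\<beta>\<in>{..<\<alpha>}. {x. lev x = \<beta>})"
    by (auto simp: below_def)
  then show ?thesis
    using countable_level countable_lessThan_omega1 by auto
qed

definition immediate_successors :: "('a \<Rightarrow> omega1 \<Rightarrow> 'a) \<Rightarrow> 'a \<Rightarrow> 'a set" where
  "immediate_successors p x = {y. lev y = suc_omega1 (lev x) \<and> p y (lev x) = x}"

definition sparse :: "('a \<Rightarrow> omega1 \<Rightarrow> 'a) \<Rightarrow> 'a set \<Rightarrow> bool" where
  "sparse p A \<longleftrightarrow> (\<forall>x. finite (A \<inter> immediate_successors p x))"

lemma sparse_mono: "sparse p A \<Longrightarrow> B \<subseteq> A \<Longrightarrow> sparse p B"
  unfolding sparse_def by (meson Int_mono finite_subset order_refl)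

definition leaves :: "'a set \<Rightarrow> omega1 \<Rightarrow> (omega1 \<Rightarrow> 'a) \<Rightarrow> bool" where
  "leaves A \<alpha> b \<longleftrightarrow> (\<exists>\<beta><\<alpha>. b (suc_omega1 \<beta>) \<notin> A)"

end

locale leveled_tree = leveling lev for lev :: "'a \<Rightarrow> omega1" +
  fixes proj :: "'a \<Rightarrow> omega1 \<Rightarrow> 'a"  (infixl "\<restriction>" 100)
  assumes level_nonempty: "\<exists>x. lev x = \<alpha>"
    and lev_proj: "\<beta> \<le> lev x \<Longrightarrow> lev (x \<restriction> \<beta>) = \<beta>"
    and proj_lev: "x \<restriction> lev x = x"
    and proj_proj: "\<gamma> \<le> \<beta> \<Longrightarrow> \<beta> \<le> lev x \<Longrightarrow> x \<restriction> \<beta> \<restriction> \<gamma> = x \<restriction> \<gamma>"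
begin

definition tree_less :: "'a \<Rightarrow> 'a \<Rightarrow> bool" where
  "tree_less x y \<longleftrightarrow> lev x < lev y \<and> y \<restriction> lev x = x"

lemma proj_eq_if_tree_less: "tree_less x y \<Longrightarrow> \<beta> \<le> lev x \<Longrightarrow> x \<restriction> \<beta> = y \<restriction> \<beta>"
  unfolding tree_less_def by (metis order_less_imp_le proj_proj)

lemma proj_tree_less_proj_iff:
  "\<beta> \<le> lev t \<Longrightarrow> \<gamma> \<le> lev t \<Longrightarrow> tree_less (t \<restriction> \<beta>) (t \<restriction> \<gamma>) \<longleftrightarrow> \<beta> < \<gamma>"
  by (auto simp: tree_less_def lev_proj proj_proj)

lemma proj_tree_less: "\<beta> < lev t \<Longrightarrow> tree_less (t \<restriction> \<beta>) t"
  using proj_tree_less_proj_iff[of \<beta> t "lev t"] by (simp add: proj_lev)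

lemma inj_on_proj: "inj_on ((\<restriction>) t) {..<lev t}"
  by (rule inj_on_inverseI[of _ lev]) (simp add: lev_proj)

lemma tree_preds_eq: "tree_preds UNIV tree_less t = (\<restriction>) t ` {..<lev t}"
proof
  show "tree_preds UNIV tree_less t \<subseteq> (\<restriction>) t ` {..<lev t}"
    by (auto simp: tree_preds_def tree_less_def intro!: image_eqI[of _ _ "lev _"])
  show "(\<restriction>) t ` {..<lev t} \<subseteq> tree_preds UNIV tree_less t"
    by (auto simp: tree_preds_def proj_tree_less)
qed

lemma tree_pred_order_eq:
  "tree_pred_order UNIV tree_less t = dir_image (segment_omega1 (lev t)) ((\<restriction>) t)"
proof -
  have "t \<restriction> \<beta> = t \<restriction> \<gamma> \<or> tree_less (t \<restriction> \<beta>) (t \<restriction> \<gamma>) \<longleftrightarrow> \<beta> \<le> \<gamma>"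
    if "\<beta> < lev t" "\<gamma> < lev t" for \<beta> \<gamma>
    using that inj_onD[OF inj_on_proj] by (auto simp: proj_tree_less_proj_iff order_le_less)
  then have "tree_pred_order UNIV tree_less t
      = {(t \<restriction> \<beta>, t \<restriction> \<gamma>) |\<beta> \<gamma>. \<beta> < lev t \<and> \<gamma> < lev t \<and> \<beta> \<le> \<gamma>}"
    unfolding tree_pred_order_def tree_preds_eq by blast
  also have "\<dots> = dir_image (segment_omega1 (lev t)) ((\<restriction>) t)"
    unfolding dir_image_def segment_omega1_def using order.strict_trans1 by blast
  finally show ?thesis .
qed

lemma Well_order_tree_pred_order: "Well_order (tree_pred_order UNIV tree_less t)"
  unfolding tree_pred_order_eq
  by (rule Well_order_dir_image[OF Well_order_segment_omega1])
    (simp add: Field_segment_omega1 inj_on_proj)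

lemma tree_pred_order_ordIso: "tree_pred_order UNIV tree_less t =o segment_omega1 (lev t)"
  unfolding tree_pred_order_eq
  by (rule ordIso_symmetric[OF dir_image_ordIso[OF Well_order_segment_omega1]])
    (simp add: Field_segment_omega1 inj_on_proj)

lemma tree_level_eq: "tree_level UNIV tree_less \<alpha> = {t. lev t = \<alpha>}"
  unfolding tree_level_def segment_omega1_def[symmetric]
  using tree_pred_order_ordIso segment_omega1_ordIso_iff ordIso_symmetric ordIso_transitive
  by blast

lemma is_tree: "is_tree UNIV tree_less"
  unfolding is_tree_def
proof (intro conjI ballI)
  show "irreflp_on UNIV tree_less"
    by (simp add: irreflp_on_def tree_less_def)
  show "transp_on UNIV tree_less"
  proof (rule transp_onI)
    fix x y z
    assume "tree_less x y" "tree_less y z"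
    then show "tree_less x z"
      using proj_eq_if_tree_less[of y z "lev x"] by (auto simp: tree_less_def)
  qed
  have "Field (tree_pred_order UNIV tree_less t) = tree_preds UNIV tree_less t" for t
    by (auto simp: Field_def tree_pred_order_def)
  then show "well_order_on (tree_preds UNIV tree_less t) (tree_pred_order UNIV tree_less t)" for t
    using Well_order_tree_pred_order[of t] by simp
qed

lemma aleph1_tree: "aleph1_tree UNIV tree_less"
  unfolding aleph1_tree_def height_omega1_def tree_level_eq
  using is_tree countable_level level_nonempty by auto

text \<open>A choice of one wedge \<open>\<up>x - (\<Union>s\<in>F x. \<up>s)\<close> for each node \<open>x\<close> is coded by a single
  set of nodes, which diamond can guess.\<close>

definition first_steps :: "('a \<Rightarrow> 'a set) \<Rightarrow> 'a set" where
  "first_steps F = {s \<restriction> suc_omega1 (lev x) |x s. s \<in> F x}"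

lemma suc_lev_le: "tree_less x y \<Longrightarrow> suc_omega1 (lev x) \<le> lev y"
  by (simp add: tree_less_def suc_omega1_le)

lemma immediate_successors_proj_suc:
  assumes "tree_less x s" "s \<restriction> suc_omega1 (lev x) \<in> immediate_successors (\<restriction>) y"
  shows "x = y"
proof -
  have "lev x = lev y" and proj: "s \<restriction> suc_omega1 (lev x) \<restriction> lev y = y"
    using assms lev_proj[OF suc_lev_le]
    by (auto simp: immediate_successors_def dest: suc_omega1_inject)
  then have "s \<restriction> suc_omega1 (lev x) \<restriction> lev y = s \<restriction> lev x"
    using proj_proj[OF less_imp_le[OF less_suc_omega1] suc_lev_le[OF assms(1)]] by simp
  then show ?thesis
    using proj assms(1) by (simp add: tree_less_def)
qed

lemma sparse_first_steps:
  assumes "\<And>x. finite (F x)" "\<And>x s. s \<in> F x \<Longrightarrow> tree_less x s"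
  shows "sparse (\<restriction>) (first_steps F)"
  unfolding sparse_def
proof
  fix x
  have "first_steps F \<inter> immediate_successors (\<restriction>) x \<subseteq> (\<lambda>s. s \<restriction> suc_omega1 (lev x)) ` F x"
    using assms(2) by (auto simp: first_steps_def dest: immediate_successors_proj_suc)
  then show "finite (first_steps F \<inter> immediate_successors (\<restriction>) x)"
    using assms(1) by (rule finite_subset[OF _ finite_imageI])
qed

lemma in_wedge_if_not_first_step:
  assumes F: "\<And>s. s \<in> F x \<Longrightarrow> tree_less x s"
    and "tree_less x y" "y \<restriction> suc_omega1 (lev x) \<notin> first_steps F"
  shows "y \<in> wedge UNIV tree_less x (F x)"
proof -
  have "y \<notin> up_set UNIV tree_less s" if s: "s \<in> F x" for s
  proof
    assume "y \<in> up_set UNIV tree_less s"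
    then have "s \<restriction> suc_omega1 (lev x) = y \<restriction> suc_omega1 (lev x)"
      using proj_eq_if_tree_less[of s y] suc_lev_le[OF F[OF s]] by (auto simp: up_set_def)
    then show False
      using assms(3) s by (auto simp: first_steps_def)
  qed
  then show ?thesis
    using assms(2) by (simp add: wedge_def up_set_def)
qed

lemma Lindelof_space_fine_wedge:
  assumes leave: "\<And>A. sparse (\<restriction>) A \<Longrightarrow> \<exists>\<alpha>. \<forall>x. lev x = \<alpha> \<longrightarrow> leaves A \<alpha> ((\<restriction>) x)"
  shows "Lindelof_space (fine_wedge_topology UNIV tree_less)"
proof (rule Lindelof_space_fine_wedgeI[OF is_tree])
  fix F
  assume F: "finite (F x) \<and> F x \<subseteq> up_set UNIV tree_less x - {x}" if "x \<in> UNIV" for x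
  then have less_F: "tree_less x s" if "s \<in> F x" for x s
    using that by (auto simp: up_set_def)
  have "sparse (\<restriction>) (first_steps F)"
    using F less_F by (simp add: sparse_first_steps)
  then obtain \<alpha> where \<alpha>: "\<And>x. lev x = \<alpha> \<Longrightarrow> leaves (first_steps F) \<alpha> ((\<restriction>) x)"
    using leave by blast
  have "\<exists>x\<in>below \<alpha>. y \<in> wedge UNIV tree_less x (F x)" for y
  proof (cases "lev y < \<alpha>")
    case True
    moreover have "y \<in> wedge UNIV tree_less y (F y)"
      using less_F by (force simp: wedge_def up_set_def tree_less_def)
    ultimately show ?thesis
      by (auto simp: below_def)
  next
    case False
    then obtain \<beta> where \<beta>: "\<beta> < \<alpha>" "y \<restriction> \<alpha> \<restriction> suc_omega1 \<beta> \<notin> first_steps F"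
      using \<alpha>[of "y \<restriction> \<alpha>"] by (auto simp: leaves_def lev_proj)
    then have "y \<restriction> suc_omega1 \<beta> \<notin> first_steps F" "tree_less (y \<restriction> \<beta>) y" "lev (y \<restriction> \<beta>) = \<beta>"
      using False by (auto simp: proj_proj proj_tree_less lev_proj suc_omega1_le)
    then have "y \<in> wedge UNIV tree_less (y \<restriction> \<beta>) (F (y \<restriction> \<beta>))"
      using less_F by (intro in_wedge_if_not_first_step) simp_all
    moreover have "y \<restriction> \<beta> \<in> below \<alpha>"
      using \<beta>(1) \<open>lev (y \<restriction> \<beta>) = \<beta>\<close> by (simp add: below_def)
    ultimately show ?thesis ..
  qed
  then show "\<exists>C. countable C \<and> C \<subseteq> UNIV \<and> UNIV \<subseteq> (\<Union>x\<in>C. wedge UNIV tree_less x (F x))"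
    by (intro exI[of _ "below \<alpha>"]) (auto simp: countable_below)
qed

end

section \<open>Construction of the tree\<close>

context leveling
begin

definition branch_below ::
    "('a \<Rightarrow> omega1 \<Rightarrow> 'a) \<Rightarrow> ('a \<Rightarrow> rat) \<Rightarrow> omega1 \<Rightarrow> rat \<Rightarrow> (omega1 \<Rightarrow> 'a) \<Rightarrow> bool" where
  "branch_below p f \<alpha> q b \<longleftrightarrow>
     (\<forall>\<beta><\<alpha>. lev (b \<beta>) = \<beta> \<and> f (b \<beta>) < q \<and> (\<forall>\<gamma>\<le>\<beta>. p (b \<beta>) \<gamma> = b \<gamma>))"

text \<open>In the tree with projections \<open>p\<close> and labels \<open>f\<close>, \<open>good_level\<close> describes level \<open>\<alpha>\<close> relative to
  the levels below it; \<open>A \<alpha>\<close> is the guess at stage \<open>\<alpha>\<close>. It is cut down to \<open>below \<alpha>\<close> because the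
  levels above \<open>\<alpha>\<close> are not yet constructed at that stage.\<close>

definition good_level ::
    "(omega1 \<Rightarrow> 'a set) \<Rightarrow> ('a \<Rightarrow> omega1 \<Rightarrow> 'a) \<Rightarrow> ('a \<Rightarrow> rat) \<Rightarrow> omega1 \<Rightarrow> bool" where
  "good_level A p f \<alpha> \<longleftrightarrow>
     (\<forall>x. lev x = \<alpha> \<longrightarrow> p x \<alpha> = x \<and> branch_below p f \<alpha> (f x) (p x)) \<and>
     (\<forall>y\<in>below \<alpha>. \<forall>q>f y. infinite {x. lev x = \<alpha> \<and> p x (lev y) = y \<and> f x < q}) \<and>
     (limit_omega1 \<alpha> \<and> sparse p (A \<alpha> \<inter> below \<alpha>) \<longrightarrow>
        (\<forall>x. lev x = \<alpha> \<longrightarrow> leaves (A \<alpha> \<inter> below \<alpha>) \<alpha> (p x)))"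

lemma branch_below_cong:
  assumes "\<And>x. lev x < \<alpha> \<Longrightarrow> p x = p' x \<and> f x = f' x" and "\<And>\<beta>. \<beta> < \<alpha> \<Longrightarrow> b \<beta> = b' \<beta>"
  shows "branch_below p f \<alpha> q b \<longleftrightarrow> branch_below p' f' \<alpha> q b'"
  unfolding branch_below_def using assms by (metis order_le_less_trans)

lemma sparse_below_cong:
  assumes "\<And>x. lev x < \<alpha> \<Longrightarrow> p x = p' x"
  shows "sparse p (A \<inter> below \<alpha>) \<longleftrightarrow> sparse p' (A \<inter> below \<alpha>)"
proof -
  have "A \<inter> below \<alpha> \<inter> immediate_successors p x = A \<inter> below \<alpha> \<inter> immediate_successors p' x" for x
    using assms by (auto simp: immediate_successors_def below_def)
  then show ?thesis
    by (simp add: sparse_def)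
qed

lemma good_level_cong:
  assumes "\<And>x. lev x \<le> \<alpha> \<Longrightarrow> p x = p' x \<and> f x = f' x"
  shows "good_level A p f \<alpha> \<longleftrightarrow> good_level A p' f' \<alpha>"
proof -
  have eq: "p x = p' x" "f x = f' x" if "lev x = \<alpha> \<or> x \<in> below \<alpha>" for x
    using assms that by (auto simp: below_def)
  have "branch_below p f \<alpha> q b \<longleftrightarrow> branch_below p' f' \<alpha> q b" for q b
    using assms by (intro branch_below_cong) simp_all
  moreover have "sparse p (A \<alpha> \<inter> below \<alpha>) \<longleftrightarrow> sparse p' (A \<alpha> \<inter> below \<alpha>)"
    using assms by (intro sparse_below_cong) simp
  ultimately show ?thesis
    unfolding good_level_def using eq by (simp cong: conj_cong)
qed

lemma good_level_proj:
  assumes "good_level A p f (lev x)"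
  shows "p x (lev x) = x"
    and "\<beta> \<le> lev x \<Longrightarrow> lev (p x \<beta>) = \<beta>"
    and "\<beta> < lev x \<Longrightarrow> f (p x \<beta>) < f x"
    and "\<gamma> \<le> \<beta> \<Longrightarrow> \<beta> \<le> lev x \<Longrightarrow> p (p x \<beta>) \<gamma> = p x \<gamma>"
  using assms by (auto simp: good_level_def branch_below_def order_le_less)

lemma ex_extension_on_good_level:
  assumes "good_level A p f \<beta>" "lev y \<le> \<beta>" "f y < q"
  shows "\<exists>x. lev x = \<beta> \<and> p x (lev y) = y \<and> f x < q"
proof (cases "lev y = \<beta>")
  case True
  then show ?thesis
    using assms good_level_proj(1)[of A p f y] by auto
next
  case False
  then have "infinite {x. lev x = \<beta> \<and> p x (lev y) = y \<and> f x < q}"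
    using assms by (simp add: good_level_def below_def)
  then show ?thesis
    using infinite_imp_nonempty by blast
qed

lemma inverse_system_below:
  assumes good: "\<And>\<beta>. \<beta> < \<alpha> \<Longrightarrow> good_level A p f \<beta>"
  shows "inverse_system {..<\<alpha>} (\<lambda>\<beta>. {x. lev x = \<beta> \<and> f x < q}) (\<lambda>\<gamma> \<beta> x. p x \<gamma>)"
proof unfold_locales
  fix \<gamma> \<beta>
  assume "\<gamma> \<in> {..<\<alpha>}" "\<beta> \<in> {..<\<alpha>}" and le: "\<gamma> \<le> \<beta>"
  then have good_\<beta>: "good_level A p f \<beta>"
    using good by simp
  show "(\<lambda>x. p x \<gamma>) ` {x. lev x = \<beta> \<and> f x < q} = {x. lev x = \<gamma> \<and> f x < q}"
  proof (intro equalityI subsetI)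
    fix y
    assume "y \<in> (\<lambda>x. p x \<gamma>) ` {x. lev x = \<beta> \<and> f x < q}"
    then obtain x where x: "lev x = \<beta>" "f x < q" and y: "y = p x \<gamma>"
      by blast
    then have good_x: "good_level A p f (lev x)"
      using good_\<beta> by simp
    have "f y \<le> f x"
      using good_level_proj(1,3)[OF good_x] x(1) y le by (auto simp: order_le_less)
    then show "y \<in> {x. lev x = \<gamma> \<and> f x < q}"
      using good_level_proj(2)[OF good_x, of \<gamma>] x y le by simp
  next
    fix y
    assume "y \<in> {x. lev x = \<gamma> \<and> f x < q}"
    then show "y \<in> (\<lambda>x. p x \<gamma>) ` {x. lev x = \<beta> \<and> f x < q}"
      using ex_extension_on_good_level[OF good_\<beta>, of y q] le by force
  qed
next
  fix \<beta> x
  assume "\<beta> \<in> {..<\<alpha>}" "x \<in> {x. lev x = \<beta> \<and> f x < q}"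
  then show "p x \<beta> = x"
    using good good_level_proj(1)[of A p f x] by auto
next
  fix \<gamma> \<beta> \<delta> x
  assume "\<delta> \<in> {..<\<alpha>}" "\<gamma> \<le> \<beta>" "\<beta> \<le> \<delta>" "x \<in> {x. lev x = \<delta> \<and> f x < q}"
  then show "p (p x \<beta>) \<gamma> = p x \<gamma>"
    using good good_level_proj(4)[of A p f x \<gamma> \<beta>] by auto
qed

lemma ex_branch_below:
  assumes good: "\<And>\<beta>. \<beta> < \<alpha> \<Longrightarrow> good_level A p f \<beta>"
    and y: "lev y < \<alpha>" and q: "f y < q"
  shows "\<exists>b. branch_below p f \<alpha> q b \<and> b (lev y) = y"
proof -
  interpret inverse_system "{..<\<alpha>}" "\<lambda>\<beta>. {x. lev x = \<beta> \<and> f x < q}" "\<lambda>\<gamma> \<beta> x. p x \<gamma>"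
    by (rule inverse_system_below[OF good])
  obtain b where "thread b" "b (lev y) = y"
    using ex_thread_through[of "lev y" y] countable_lessThan_omega1 y q by auto
  then show ?thesis
    by (intro exI[of _ b]) (auto simp: thread_def branch_below_def)
qed

lemma ex_leaving_branch_below:
  assumes good: "\<And>\<beta>. \<beta> < \<alpha> \<Longrightarrow> good_level A p f \<beta>"
    and y: "lev y < \<alpha>" and q: "f y < q"
    and "limit_omega1 \<alpha>" "sparse p G"
  shows "\<exists>b. branch_below p f \<alpha> q b \<and> b (lev y) = y \<and> leaves G \<alpha> b"
proof -
  let ?s = "suc_omega1 (lev y)"
  have s: "lev y < ?s" "?s < \<alpha>"
    using \<open>limit_omega1 \<alpha>\<close> y less_suc_omega1 by (auto simp: limit_omega1_def)
  have "infinite {x. lev x = ?s \<and> p x (lev y) = y \<and> f x < q}"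
    using good[OF s(2)] s(1) q by (simp add: good_level_def below_def)
  moreover have "finite (G \<inter> immediate_successors p y)"
    using \<open>sparse p G\<close> by (simp add: sparse_def)
  ultimately have "\<not> {x. lev x = ?s \<and> p x (lev y) = y \<and> f x < q} \<subseteq> G \<inter> immediate_successors p y"
    using finite_subset by blast
  then obtain x where x: "lev x = ?s" "p x (lev y) = y" "f x < q" "x \<notin> G"
    by (auto simp: immediate_successors_def)
  obtain b where b: "branch_below p f \<alpha> q b" "b ?s = x"
    using ex_branch_below[OF good, of \<alpha> x q] x(1,3) s(2) by auto
  have "b (lev y) = y"
    using b s x(2) by (auto simp: branch_below_def)
  moreover have "leaves G \<alpha> b"
    using y b(2) x(4) by (auto simp: leaves_def)
  ultimately show ?thesis
    using b(1) by blast
qed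

lemma ex_branch_ending_in:
  assumes good: "\<And>\<beta>. \<beta> < \<alpha> \<Longrightarrow> good_level A p f \<beta>"
    and y: "lev y < \<alpha>" and q: "f y < q"
  shows "\<exists>b. b \<alpha> = x \<and> branch_below p f \<alpha> q b \<and> b (lev y) = y \<and>
    (limit_omega1 \<alpha> \<and> sparse p G \<longrightarrow> leaves G \<alpha> b)"
proof -
  obtain b where b: "branch_below p f \<alpha> q b" "b (lev y) = y"
    and leave: "limit_omega1 \<alpha> \<and> sparse p G \<longrightarrow> leaves G \<alpha> b"
    using ex_branch_below[of \<alpha> A p f y q] ex_leaving_branch_below[of \<alpha> A p f y q G] assms by metis
  have "branch_below p f \<alpha> q (b(\<alpha> := x))"
    using b(1) by (subst branch_below_cong[where b' = b]) auto
  moreover have "leaves G \<alpha> (b(\<alpha> := x))" if "limit_omega1 \<alpha>" "sparse p G"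
    using leave that by (auto simp: leaves_def limit_omega1_def)
  ultimately show ?thesis
    using b(2) y by (intro exI[of _ "b(\<alpha> := x)"]) auto
qed

lemma good_levelI:
  assumes agree: "\<And>x. lev x < \<alpha> \<Longrightarrow> p' x = p x \<and> f' x = f x"
    and self: "\<And>x. lev x = \<alpha> \<Longrightarrow> p' x \<alpha> = x"
    and branch: "\<And>x. lev x = \<alpha> \<Longrightarrow> branch_below p f \<alpha> (f' x) (p' x)"
    and inf: "\<And>y q. y \<in> below \<alpha> \<Longrightarrow> f y < q \<Longrightarrow>
      infinite {x. lev x = \<alpha> \<and> p' x (lev y) = y \<and> f' x = q}"
    and leave: "\<And>x. lev x = \<alpha> \<Longrightarrow> limit_omega1 \<alpha> \<Longrightarrow> sparse p (A \<alpha> \<inter> below \<alpha>) \<Longrightarrow>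
      leaves (A \<alpha> \<inter> below \<alpha>) \<alpha> (p' x)"
  shows "good_level A p' f' \<alpha>"
proof -
  have "branch_below p' f' \<alpha> q b \<longleftrightarrow> branch_below p f \<alpha> q b" for q b
    using agree by (intro branch_below_cong) auto
  moreover have "sparse p' (A \<alpha> \<inter> below \<alpha>) \<longleftrightarrow> sparse p (A \<alpha> \<inter> below \<alpha>)"
    using agree by (intro sparse_below_cong) simp
  moreover have "infinite {x. lev x = \<alpha> \<and> p' x (lev y) = y \<and> f' x < q}"
    if y: "y \<in> below \<alpha>" and q: "f' y < q" for y q
  proof -
    obtain q' where q': "f y < q'" "q' < q"
      using dense[OF q] agree[of y] y by (auto simp: below_def)
    have "{x. lev x = \<alpha> \<and> p' x (lev y) = y \<and> f' x = q'}
        \<subseteq> {x. lev x = \<alpha> \<and> p' x (lev y) = y \<and> f' x < q}"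
      using q'(2) by auto
    then show ?thesis
      using inf[OF y q'(1)] by (rule infinite_super)
  qed
  ultimately show ?thesis
    using self branch leave by (simp add: good_level_def)
qed

lemma ex_node_bound_enumeration:
  fixes f :: "'a \<Rightarrow> rat"
  assumes "infinite {x. lev x = \<alpha>}" "below \<alpha> \<noteq> {}"
  shows "\<exists>y q. (\<forall>x. lev x = \<alpha> \<longrightarrow> lev (y x) < \<alpha> \<and> f (y x) < q x) \<and>
    (\<forall>z\<in>below \<alpha>. \<forall>r>f z. infinite {x. lev x = \<alpha> \<and> y x = z \<and> q x = r})"
proof -
  define D where "D = {(z, r). z \<in> below \<alpha> \<and> f z < r}"
  have "countable D"
    by (rule countable_subset[of _ "below \<alpha> \<times> UNIV"]) (auto simp: D_def countable_below)
  moreover have "D \<noteq> {}"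
    using assms(2) gt_ex by (fastforce simp: D_def)
  ultimately obtain d where d: "d ` {x. lev x = \<alpha>} \<subseteq> D"
    and "\<forall>w\<in>D. infinite {x \<in> {x. lev x = \<alpha>}. d x = w}"
    using ex_map_infinite_fibres[OF assms(1), of D] by auto
  then have "infinite {x. lev x = \<alpha> \<and> fst (d x) = z \<and> snd (d x) = r}"
    if "z \<in> below \<alpha>" "f z < r" for z r
    using that by (simp add: D_def prod_eq_iff)
  then show ?thesis
    using d by (intro exI[of _ "fst \<circ> d"] exI[of _ "snd \<circ> d"]) (auto simp: D_def below_def)
qed

lemma ex_good_level_extension:
  assumes infinite_level: "\<And>\<alpha>. infinite {x. lev x = \<alpha>}"
    and good: "\<And>\<beta>. \<beta> < \<alpha> \<Longrightarrow> good_level A p f \<beta>"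
  shows "\<exists>p' f'. (\<forall>x. lev x < \<alpha> \<longrightarrow> p' x = p x \<and> f' x = f x) \<and> good_level A p' f' \<alpha>"
proof (cases "below \<alpha> = {}")
  case True
  then have "\<not> \<beta> < \<alpha>" for \<beta>
    using infinite_imp_nonempty[OF infinite_level[of \<beta>]] by (auto simp: below_def)
  then have "good_level A (\<lambda>x _. x) f \<alpha>"
    using True by (auto simp: good_level_def branch_below_def limit_omega1_def)
  then show ?thesis
    using True by (auto simp: below_def)
next
  case False
  obtain y q where y: "\<And>x. lev x = \<alpha> \<Longrightarrow> lev (y x) < \<alpha> \<and> f (y x) < q x"
    and inf: "\<And>z r. z \<in> below \<alpha> \<Longrightarrow> f z < r \<Longrightarrow> infinite {x. lev x = \<alpha> \<and> y x = z \<and> q x = r}"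
    using ex_node_bound_enumeration[OF infinite_level False, of f] by blast
  have "\<exists>b. b \<alpha> = x \<and> branch_below p f \<alpha> (q x) b \<and> b (lev (y x)) = y x \<and>
      (limit_omega1 \<alpha> \<and> sparse p (A \<alpha> \<inter> below \<alpha>) \<longrightarrow> leaves (A \<alpha> \<inter> below \<alpha>) \<alpha> b)"
    if "lev x = \<alpha>" for x
    using y[OF that] by (intro ex_branch_ending_in[OF good]) auto
  then obtain b where b: "\<And>x. lev x = \<alpha> \<Longrightarrow> b x \<alpha> = x"
    "\<And>x. lev x = \<alpha> \<Longrightarrow> branch_below p f \<alpha> (q x) (b x)"
    and through: "\<And>x. lev x = \<alpha> \<Longrightarrow> b x (lev (y x)) = y x"
    and leave: "\<And>x. lev x = \<alpha> \<Longrightarrow> limit_omega1 \<alpha> \<and> sparse p (A \<alpha> \<inter> below \<alpha>) \<longrightarrow>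
      leaves (A \<alpha> \<inter> below \<alpha>) \<alpha> (b x)"
    by metis
  define p' where "p' x = (if lev x = \<alpha> then b x else p x)" for x
  define f' where "f' x = (if lev x = \<alpha> then q x else f x)" for x
  have "good_level A p' f' \<alpha>"
  proof (rule good_levelI)
    fix z r
    assume "z \<in> below \<alpha>" "f z < r"
    moreover have "{x. lev x = \<alpha> \<and> y x = z \<and> q x = r}
        \<subseteq> {x. lev x = \<alpha> \<and> p' x (lev z) = z \<and> f' x = r}"
      using through by (force simp: p'_def f'_def)
    ultimately show "infinite {x. lev x = \<alpha> \<and> p' x (lev z) = z \<and> f' x = r}"
      using inf infinite_super by blast
  qed (use b leave in \<open>auto simp: p'_def f'_def\<close>)
  then show ?thesis
    by (intro exI[of _ p'] exI[of _ f']) (simp add: p'_def f'_def)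
qed

lemma ex_all_levels_good:
  assumes "\<And>\<alpha>. infinite {x. lev x = \<alpha>}"
  shows "\<exists>p f. \<forall>\<alpha>. good_level A p f \<alpha>"
proof -
  have "\<exists>F. \<forall>\<alpha>. good_level A (fst \<circ> F) (snd \<circ> F) \<alpha>"
  proof (rule ex_levelwise_choice[of lev])
    show "good_level A (fst \<circ> F) (snd \<circ> F) \<alpha> = good_level A (fst \<circ> F') (snd \<circ> F') \<alpha>"
      if "\<And>x. lev x \<le> \<alpha> \<Longrightarrow> F x = F' x" for F F' \<alpha>
      using that by (intro good_level_cong) simp
    fix F \<alpha>
    assume "\<And>\<beta>. \<beta> < \<alpha> \<Longrightarrow> good_level A (fst \<circ> F) (snd \<circ> F) \<beta>"
    then obtain p f where "\<forall>x. lev x < \<alpha> \<longrightarrow> p x = fst (F x) \<and> f x = snd (F x)"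
      and "good_level A p f \<alpha>"
      using ex_good_level_extension[OF assms, of \<alpha> A "fst \<circ> F" "snd \<circ> F"] by auto
    then show "\<exists>F'. (\<forall>x. lev x < \<alpha> \<longrightarrow> F' x = F x) \<and> good_level A (fst \<circ> F') (snd \<circ> F') \<alpha>"
      by (intro exI[of _ "\<lambda>x. (p x, f x)"]) (simp add: comp_def)
  qed
  then show ?thesis
    by blast
qed

end

locale good_tree = leveling lev for lev :: "'a \<Rightarrow> omega1" +
  fixes A :: "omega1 \<Rightarrow> 'a set" and p :: "'a \<Rightarrow> omega1 \<Rightarrow> 'a" and f :: "'a \<Rightarrow> rat"
  assumes level_nonempty: "\<exists>x. lev x = \<alpha>"
    and good: "good_level A p f \<alpha>"
begin

sublocale leveled_tree lev p
  by unfold_locales (simp_all add: level_nonempty good_level_proj[OF good])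

lemma special_tree: "special_tree UNIV tree_less"
proof (rule special_treeI)
  show "f x \<noteq> f y" if "tree_less x y" for x y
    using good_level_proj(3)[OF good, of "lev x" y] that by (auto simp: tree_less_def)
qed

lemma Lindelof_if_guessing:
  assumes guess: "\<And>X. \<exists>\<alpha>. limit_omega1 \<alpha> \<and> A \<alpha> \<inter> below \<alpha> = X \<inter> below \<alpha>"
  shows "Lindelof_space (fine_wedge_topology UNIV tree_less)"
proof (rule Lindelof_space_fine_wedge)
  fix X
  assume "sparse p X"
  obtain \<alpha> where lim: "limit_omega1 \<alpha>" and \<alpha>: "A \<alpha> \<inter> below \<alpha> = X \<inter> below \<alpha>"
    using guess by blast
  have "sparse p (A \<alpha> \<inter> below \<alpha>)"
    using \<open>sparse p X\<close> \<alpha> by (simp add: sparse_mono[OF _ Int_lower1])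
  then have "leaves (X \<inter> below \<alpha>) \<alpha> (p x)" if "lev x = \<alpha>" for x
    using good[of \<alpha>] lim that \<alpha> by (simp add: good_level_def)
  then have "leaves X \<alpha> (p x)" if "lev x = \<alpha>" for x
    using that lim lev_proj by (fastforce simp: leaves_def below_def limit_omega1_def)
  then show "\<exists>\<alpha>. \<forall>x. lev x = \<alpha> \<longrightarrow> leaves X \<alpha> (p x)"
    by blast
qed

end

lemma diamond_guesses_below:
  fixes lev :: "omega1 \<Rightarrow> omega1"
  assumes "diamond" "leveling lev"
  shows "\<exists>A. \<forall>X. \<exists>\<alpha>. limit_omega1 \<alpha> \<and> A \<alpha> \<inter> leveling.below lev \<alpha> = X \<inter> leveling.below lev \<alpha>"
proof -
  interpret leveling lev
    by fact
  obtain A :: "omega1 \<Rightarrow> omega1 set" where A: "\<And>X. stationary {\<alpha>. X \<inter> {..<\<alpha>} = A \<alpha>}"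
    using \<open>diamond\<close> unfolding diamond_def by blast
  have "\<exists>\<gamma>. \<forall>\<delta>\<in>insert (suc_omega1 \<beta>) {x. lev x = \<beta>}. \<delta> < \<gamma>" for \<beta>
    using ex_strict_supremum_omega1[of "insert (suc_omega1 \<beta>) {x. lev x = \<beta>}"] countable_level
    by auto
  then obtain h where h: "\<And>\<beta>. suc_omega1 \<beta> < h \<beta>" "\<And>x. x < h (lev x)"
    by simp metis
  have "\<exists>\<alpha>. limit_omega1 \<alpha> \<and> A \<alpha> \<inter> below \<alpha> = X \<inter> below \<alpha>" for X
  proof -
    obtain \<alpha> where \<alpha>: "X \<inter> {..<\<alpha>} = A \<alpha>" "{..<\<alpha>} \<noteq> {}" "\<And>\<beta>. \<beta> < \<alpha> \<Longrightarrow> h \<beta> < \<alpha>"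
      using A[of X] club_closure_points[of h] unfolding stationary_def by blast
    have "limit_omega1 \<alpha>"
      unfolding limit_omega1_def using \<alpha>(2,3) h(1) order.strict_trans by blast
    moreover have "below \<alpha> \<subseteq> {..<\<alpha>}"
      unfolding below_def using \<alpha>(3) h(2) order.strict_trans by blast
    ultimately show ?thesis
      using \<alpha>(1) by blast
  qed
  then show ?thesis
    by blast
qed

theorem theorem5p5:
  assumes "diamond"
  shows "\<exists>(T :: omega1 set) (lt :: omega1 \<Rightarrow> omega1 \<Rightarrow> bool).
           aleph1_tree T lt \<and> special_tree T lt \<and> Lindelof_space (fine_wedge_topology T lt)"
proof -
  obtain lev :: "omega1 \<Rightarrow> omega1"
    where lev: "\<And>\<alpha>. countable {x. lev x = \<alpha>}" "\<And>\<alpha>. infinite {x. lev x = \<alpha>}"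
    using ex_countably_infinite_fibres_omega1 by blast
  interpret leveling lev
    by unfold_locales (rule lev(1))
  obtain A where A: "\<And>X. \<exists>\<alpha>. limit_omega1 \<alpha> \<and> A \<alpha> \<inter> below \<alpha> = X \<inter> below \<alpha>"
    using diamond_guesses_below[OF assms leveling_axioms] by blast
  obtain p f where good: "\<And>\<alpha>. good_level A p f \<alpha>"
    using ex_all_levels_good[OF lev(2)] by blast
  interpret good_tree lev A p f
    by unfold_locales (use lev(2) infinite_imp_nonempty good in blast)+
  show ?thesis
    using aleph1_tree special_tree Lindelof_if_guessing[OF A] by blast
qed

end
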